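(* Let $G$ be a graph with maximum degree $\Delta$. Then $$\frac{\sigma_1(G)}{\sigma_0(G)}\geq \min \left\lbrace \frac{1}{3},\frac{\sigma_1(S_{\Delta+1})}{\sigma_0(S_{\Delta+1})}\right\rbrace .$$ Equality happens if and only if $G$ is $S_{\Delta+1}\cup \overline{K_{|V(G)|-\Delta -1}}$.
   Context: All graphs are finite and simple. For a graph $G$ and an integer $k\ge 0$, $\sigma_k(G)$ denotes the number of subsets $A\subseteq V(G)$ such that the subgraph of $G$ induced by $A$ has exactly $k$ edges. Thus $\sigma_0(G)$ is the number of independent vertex subsets of $G$ (including the empty set), and $\sigma_1(G)$ is the number of vertex subsets inducing exactly one edge. $S_m$ denotes the star with $m$ vertices (one centre joined to $m-1$ leaves; $S_1$ is a single vertex). $\overline{K_m}$ denotes the graph with $m$ vertices and no edges (the empty graph if $m=0$), and $\cup$ denotes disjoint union of graphs. Equality of graphs is understood up to isomorphism.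
   Formalization: The equality clause is corrected to exclude Δ = 2: S_3 has ratio 2/5 > 1/3, so equality fails there; it is proved that equality holds iff Δ ≠ 2 and G is the star with isolated vertices. G is assumed to have at least one vertex. *)

theory Defs
  imports Complex_Main
begin

type_synonym 'a sgraph = "'a set \<times> 'a set set"

abbreviation verts :: "'a sgraph \<Rightarrow> 'a set" where
  "verts G \<equiv> fst G"

abbreviation edges :: "'a sgraph \<Rightarrow> 'a set set" where
  "edges G \<equiv> snd G"

definition finite_simple_graph :: "'a sgraph \<Rightarrow> bool" where
  "finite_simple_graph G \<longleftrightarrow>
     finite (verts G) \<and> (\<forall>e\<in>edges G. e \<subseteq> verts G \<and> card e = 2)"

definition induced_subgraph :: "'a sgraph \<Rightarrow> 'a set \<Rightarrow> 'a sgraph" where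
  "induced_subgraph G A = (A, {e \<in> edges G. e \<subseteq> A})"

definition sigma_graph :: "nat \<Rightarrow> 'a sgraph \<Rightarrow> nat" where
  "sigma_graph k G = card {A. A \<subseteq> verts G \<and> card (edges (induced_subgraph G A)) = k}"

definition vertex_degree :: "'a sgraph \<Rightarrow> 'a \<Rightarrow> nat" where
  "vertex_degree G v = card {e \<in> edges G. v \<in> e}"

text \<open>Only meaningful for graphs with a nonempty finite vertex set.\<close>

definition max_degree :: "'a sgraph \<Rightarrow> nat" where
  "max_degree G = Max (vertex_degree G ` verts G)"

text \<open>The star has \<open>m\<close> vertices, that is, \<open>m - 1\<close> leaves.\<close>

definition star :: "nat \<Rightarrow> nat sgraph" where
  "star m = ({..<m}, {{0, i} | i. 0 < i \<and> i < m})"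

definition edgeless :: "nat \<Rightarrow> nat sgraph" where
  "edgeless m = ({..<m}, {})"

definition disjoint_union :: "'a sgraph \<Rightarrow> 'b sgraph \<Rightarrow> ('a + 'b) sgraph" where
  "disjoint_union G H =
     (verts G <+> verts H, (`) Inl ` edges G \<union> (`) Inr ` edges H)"

definition isomorphic :: "'a sgraph \<Rightarrow> 'b sgraph \<Rightarrow> bool" where
  "isomorphic G H \<longleftrightarrow>
     (\<exists>f. bij_betw f (verts G) (verts H) \<and> edges H = (`) f ` edges G)"

end

theory Submission
  imports Defs
begin

text \<open>
  Write \<open>i(W)\<close> and \<open>s(W)\<close> for the numbers of subsets of a vertex set \<open>W\<close> that induce no edge and
  exactly one edge, and \<open>N(v)\<close>, \<open>N[v]\<close> for the open and closed neighbourhoods of \<open>v\<close>. Sorting the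
  subsets by whether they contain a fixed vertex \<open>v\<close>, and if so which neighbour of \<open>v\<close>, gives
  \<open>i(W) = i(W - v) + i(W - N[v])\<close> and
  \<open>s(W) = s(W - v) + s(W - N[v]) + T\<close>, where \<open>T\<close> is the sum of \<open>i(W - N[v] - N(u))\<close> over the
  neighbours \<open>u\<close> of \<open>v\<close>; the summand for \<open>u\<close> counts the sets whose only edge is \<open>vu\<close>.

  Let \<open>v\<close> have maximum degree \<open>d \<ge> 1\<close> in \<open>W\<close> and put \<open>c(d) = min (1/3) (d / (2^d + 1))\<close>, where
  \<open>d / (2^d + 1)\<close> is the ratio of the star with \<open>d\<close> leaves.

  If some edge avoids \<open>v\<close>, then \<open>s(W) > c(d) i(W)\<close> by induction. The bound holds for \<open>W - v\<close>, and
  also for \<open>W - N[v]\<close> if an edge is left there; then \<open>T > 0\<close> makes the inequality strict. If no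
  edge is left in \<open>W - N[v]\<close>, a set of \<open>m\<close> vertices, then \<open>i(W - N[v]) = 2^m\<close>. A neighbour of \<open>v\<close>
  has at most \<open>d - 1\<close> neighbours besides \<open>v\<close>, so each summand of \<open>T\<close> is at least \<open>2^m / 2^(d - 1)\<close>,
  and \<open>T \<ge> 2 (d / 2^d) 2^m > c(d) 2^m\<close> on its own. The induction passes to graphs of smaller
  maximum degree \<open>d' \<ge> 1\<close>, which is harmless because \<open>c\<close> is antitone on the positive integers: the
  cap \<open>1/3\<close> hides the increase of \<open>d / (2^d + 1)\<close> from \<open>1/3\<close> at \<open>d = 1\<close> to \<open>2/5\<close> at \<open>d = 2\<close>.

  If every edge contains \<open>v\<close>, the graph is a star with isolated vertices and its ratio is exactly
  \<open>d / (2^d + 1)\<close>, which equals \<open>c(d)\<close> unless \<open>d = 2\<close>; this covers graphs without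
  edges, where both sides are \<open>0\<close>. So equality holds exactly for these graphs with \<open>d \<noteq> 2\<close>. The main steps are \<open>strict_if_edge_avoids\<close>, \<open>ratio_bound\<close>, \<open>star_ratio\<close> and
  \<open>isomorphic_star_edgeless_iff\<close>.
\<close>

section \<open>Vertex sets inducing no edge or one edge\<close>

text \<open>
  The edge set \<open>E\<close> stays fixed while the vertex set \<open>W\<close> shrinks: edges that leave \<open>W\<close> are never
  contained in a subset of \<open>W\<close>, so they need not be deleted when passing to induced subgraphs.
\<close>

definition independent_sets :: "'a set set \<Rightarrow> 'a set \<Rightarrow> 'a set set" where
  "independent_sets E W = {A. A \<subseteq> W \<and> (\<forall>e\<in>E. \<not> e \<subseteq> A)}"

definition one_edge_sets :: "'a set set \<Rightarrow> 'a set \<Rightarrow> 'a set set" where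
  "one_edge_sets E W = {A. A \<subseteq> W \<and> (\<exists>!e. e \<in> E \<and> e \<subseteq> A)}"

definition neighbours :: "'a set set \<Rightarrow> 'a \<Rightarrow> 'a set" where
  "neighbours E v = {u. {v, u} \<in> E}"

lemma finite_independent_sets [simp]: "finite W \<Longrightarrow> finite (independent_sets E W)"
  unfolding independent_sets_def by simp

lemma finite_one_edge_sets [simp]: "finite W \<Longrightarrow> finite (one_edge_sets E W)"
  unfolding one_edge_sets_def by simp

lemma sigma_graph_0:
  assumes "finite (verts G)"
  shows "sigma_graph 0 G = card (independent_sets (edges G) (verts G))"
proof -
  have "card {e \<in> edges G. e \<subseteq> A} = 0 \<longleftrightarrow> (\<forall>e\<in>edges G. \<not> e \<subseteq> A)" if "A \<subseteq> verts G" for A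
  proof -
    have "finite {e \<in> edges G. e \<subseteq> A}"
      using finite_subset[OF that assms] by simp
    then show ?thesis by auto
  qed
  then have "{A. A \<subseteq> verts G \<and> card {e \<in> edges G. e \<subseteq> A} = 0}
      = independent_sets (edges G) (verts G)"
    unfolding independent_sets_def by blast
  then show ?thesis
    by (simp add: sigma_graph_def induced_subgraph_def)
qed

lemma sigma_graph_1:
  "sigma_graph 1 G = card (one_edge_sets (edges G) (verts G))"
proof -
  have "card {e \<in> edges G. e \<subseteq> A} = 1 \<longleftrightarrow> (\<exists>!e. e \<in> edges G \<and> e \<subseteq> A)" for A
  proof -
    have "card {e \<in> edges G. e \<subseteq> A} = 1 \<longleftrightarrow> (\<exists>e. {e \<in> edges G. e \<subseteq> A} = {e})"
      by (simp add: card_1_singleton_iff)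
    also have "\<dots> \<longleftrightarrow> (\<exists>!e. e \<in> edges G \<and> e \<subseteq> A)"
      unfolding Ex1_def by (rule ex_cong1) blast
    finally show ?thesis .
  qed
  then show ?thesis
    by (simp add: sigma_graph_def induced_subgraph_def one_edge_sets_def)
qed

lemma independent_sets_edgeless:
  assumes "\<And>e. e \<in> E \<Longrightarrow> \<not> e \<subseteq> W"
  shows "independent_sets E W = Pow W"
  using assms unfolding independent_sets_def by blast

lemma one_edge_sets_edgeless:
  assumes "\<And>e. e \<in> E \<Longrightarrow> \<not> e \<subseteq> W"
  shows "one_edge_sets E W = {}"
  using assms unfolding one_edge_sets_def by blast

lemma card_independent_sets_pos:
  assumes "finite W" "{} \<notin> E"
  shows "0 < card (independent_sets E W)"
proof -
  have "{} \<in> independent_sets E W"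
    using assms unfolding independent_sets_def by auto
  then show ?thesis
    using assms by (auto simp: card_gt_0_iff)
qed

section \<open>Deleting a vertex\<close>

locale edge_set =
  fixes E :: "'a set set"
  assumes card_edge: "e \<in> E \<Longrightarrow> card e = 2"
begin

abbreviation "N \<equiv> neighbours E"

abbreviation "i W \<equiv> card (independent_sets E W)"

abbreviation "s W \<equiv> card (one_edge_sets E W)"

lemma empty_not_edge: "{} \<notin> E"
  using card_edge[of "{}"] by auto

lemma not_neighbour_self: "v \<notin> N v"
  using card_edge[of "{v}"] by (auto simp: neighbours_def)

lemma neighbours_sym: "u \<in> N v \<longleftrightarrow> v \<in> N u"
  by (simp add: neighbours_def insert_commute)

text \<open>
  This controls the edges that appear when a vertex is put back, and so drives both recurrences.
\<close>

lemma edge_in_insertE: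
  assumes "e \<in> E" "e \<subseteq> insert v B"
  obtains "e \<subseteq> B" | w where "w \<in> B" "w \<in> N v" "e = {v, w}"
proof (cases "v \<in> e")
  case True
  obtain x y where xy: "e = {x, y}" "x \<noteq> y"
    using card_edge[OF assms(1)] by (auto simp: card_2_iff)
  then obtain w where "e = {v, w}" "w \<noteq> v"
    using True by (metis doubleton_eq_iff insert_iff singletonD)
  then show ?thesis
    using assms that(2) by (auto simp: neighbours_def)
next
  case False
  then show ?thesis using assms that(1) by blast
qed

lemma independent_sets_split:
  assumes "v \<in> W"
  shows "independent_sets E W
    = independent_sets E (W - {v}) \<union> insert v ` independent_sets E (W - insert v (N v))"
    (is "?L = ?R1 \<union> ?R2")
proof (intro equalityI subsetI)
  fix A assume A: "A \<in> ?L"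
  show "A \<in> ?R1 \<union> ?R2"
  proof (cases "v \<in> A")
    case True
    have "A - {v} \<in> independent_sets E (W - insert v (N v))"
      using A True by (auto simp: independent_sets_def neighbours_def)
    moreover have "A = insert v (A - {v})" using True by blast
    ultimately show ?thesis by blast
  qed (use A in \<open>auto simp: independent_sets_def\<close>)
next
  fix A assume "A \<in> ?R1 \<union> ?R2"
  then show "A \<in> ?L"
  proof
    assume "A \<in> ?R2"
    then obtain B where B: "B \<in> independent_sets E (W - insert v (N v))" "A = insert v B" by blast
    then have "\<not> e \<subseteq> A" if "e \<in> E" for e
      using that by (auto simp: independent_sets_def elim!: edge_in_insertE[OF that])
    then show ?thesis
      using B assms by (auto simp: independent_sets_def)
  qed (auto simp: independent_sets_def)
qed

lemma independent_sets_recurrence: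
  assumes "finite W" "v \<in> W"
  shows "i W = i (W - {v}) + i (W - insert v (N v))"
proof -
  have "inj_on (insert v) (independent_sets E (W - insert v (N v)))"
    by (rule inj_onI) (auto simp: independent_sets_def)
  moreover have "independent_sets E (W - {v})
      \<inter> insert v ` independent_sets E (W - insert v (N v)) = {}"
    by (auto simp: independent_sets_def)
  ultimately show ?thesis
    using assms by (simp add: independent_sets_split[of v W] card_Un_disjoint card_image)
qed

text \<open>
  A set with a single edge that contains \<open>v\<close> contains at most one neighbour of \<open>v\<close>. Without a
  neighbour, its edge survives the removal of \<open>v\<close>. With the neighbour \<open>u\<close>, the edge is \<open>vu\<close>, so the
  other elements are independent and adjacent to neither \<open>u\<close> nor \<open>v\<close>.
\<close>

lemma one_edge_sets_split:
  assumes "v \<in> W"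
  shows "one_edge_sets E W
    = one_edge_sets E (W - {v}) \<union> insert v ` one_edge_sets E (W - insert v (N v))
      \<union> (\<Union>u\<in>N v \<inter> W. (\<lambda>B. insert v (insert u B)) ` independent_sets E (W - insert v (N v) - N u))"
    (is "?L = ?R1 \<union> ?R2 \<union> ?R3")
proof (intro equalityI subsetI)
  fix A assume A: "A \<in> ?L"
  then obtain f where f: "f \<in> E" "f \<subseteq> A" "\<And>e. e \<in> E \<Longrightarrow> e \<subseteq> A \<Longrightarrow> e = f" "A \<subseteq> W"
    unfolding one_edge_sets_def by blast
  consider "v \<notin> A" | "v \<in> A" "A \<inter> N v = {}" | u where "v \<in> A" "u \<in> A" "u \<in> N v" by blast
  then show "A \<in> ?R1 \<union> ?R2 \<union> ?R3"
  proof cases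
    case 1
    then show ?thesis using A by (auto simp: one_edge_sets_def)
  next
    case 2
    have Av: "A = insert v (A - {v})" using 2 by blast
    have "f \<subseteq> insert v (A - {v})" using f(2) by blast
    then have "f \<subseteq> A - {v}"
      by (rule edge_in_insertE[OF f(1)]) (use 2 in auto)
    then have "\<exists>!e. e \<in> E \<and> e \<subseteq> A - {v}"
      using f(1) by (rule_tac a = f in ex1I) (use f(3) in blast)+
    moreover have "A - {v} \<subseteq> W - insert v (N v)" using f(4) 2 by blast
    ultimately have "A - {v} \<in> one_edge_sets E (W - insert v (N v))"
      by (simp add: one_edge_sets_def)
    then have "A \<in> ?R2" using Av by (rule image_eqI[rotated])
    then show ?thesis by blast
  next
    case 3
    have fu: "f = {v, u}"
      using f(3)[of "{v, u}"] 3 by (simp add: neighbours_def)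
    have v: "w = u" if "w \<in> A" "w \<in> N v" for w
      using f(3)[of "{v, w}"] that 3 fu by (auto simp: neighbours_def doubleton_eq_iff)
    have u: "w = v" if "w \<in> A" "w \<in> N u" for w
      using f(3)[of "{u, w}"] that 3 fu by (auto simp: neighbours_def doubleton_eq_iff)
    let ?B = "A - {v, u}"
    have "\<not> e \<subseteq> ?B" if "e \<in> E" for e
      using f(3)[OF that] fu by blast
    moreover have "?B \<subseteq> W - insert v (N v) - N u" using f(4) u v by blast
    ultimately have "?B \<in> independent_sets E (W - insert v (N v) - N u)"
      by (simp add: independent_sets_def)
    moreover have "A = insert v (insert u ?B)" using 3 by blast
    moreover have "u \<in> N v \<inter> W" using 3 f(4) by blast
    ultimately have "A \<in> ?R3" by (intro UN_I image_eqI)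
    then show ?thesis by blast
  qed
next
  fix A assume "A \<in> ?R1 \<union> ?R2 \<union> ?R3"
  then consider "A \<in> ?R1" | "A \<in> ?R2" | "A \<in> ?R3" by blast
  then show "A \<in> ?L"
  proof cases
    case 1
    then show ?thesis by (auto simp: one_edge_sets_def)
  next
    case 2
    then obtain B where B': "B \<in> one_edge_sets E (W - insert v (N v))" and A: "A = insert v B"
      by (rule imageE)
    then have B: "B \<subseteq> W - insert v (N v)" "\<exists>!e. e \<in> E \<and> e \<subseteq> B"
      by (simp_all add: one_edge_sets_def)
    have "e \<subseteq> A \<longleftrightarrow> e \<subseteq> B" if e: "e \<in> E" for e
    proof
      assume "e \<subseteq> A"
      then show "e \<subseteq> B"
        unfolding A by (rule edge_in_insertE[OF e]) (use B(1) in blast)+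
    qed (use A in blast)
    then have "\<exists>!e. e \<in> E \<and> e \<subseteq> A"
      using B(2) by (simp cong: conj_cong)
    moreover have "A \<subseteq> W" using B(1) A assms by blast
    ultimately show ?thesis
      by (simp add: one_edge_sets_def)
  next
    case 3
    then obtain u B where u: "u \<in> N v" "u \<in> W"
      and B: "B \<subseteq> W - insert v (N v) - N u" "\<And>e. e \<in> E \<Longrightarrow> \<not> e \<subseteq> B" "A = insert v (insert u B)"
      by (auto simp: independent_sets_def)
    have "e = {v, u}" if e: "e \<in> E" "e \<subseteq> A" for e
      using e(1) e(2)[unfolded B(3)]
    proof (rule edge_in_insertE)
      assume "e \<subseteq> insert u B"
      with e(1) show ?thesis
        by (rule edge_in_insertE) (use B e in auto)
    qed (use B in auto)
    moreover have "{v, u} \<in> E" "{v, u} \<subseteq> A"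
      using u B by (auto simp: neighbours_def)
    ultimately have "\<exists>!e. e \<in> E \<and> e \<subseteq> A" by (rule_tac ex1I) blast+
    moreover have "A \<subseteq> W" using B u assms by blast
    ultimately show ?thesis
      by (simp add: one_edge_sets_def)
  qed
qed

lemma one_edge_sets_recurrence:
  assumes "finite W" "v \<in> W"
  shows "s W = s (W - {v}) + s (W - insert v (N v))
    + (\<Sum>u\<in>N v \<inter> W. i (W - insert v (N v) - N u))"
proof -
  let ?X = "W - insert v (N v)"
  let ?R1 = "one_edge_sets E (W - {v})" and ?R2 = "insert v ` one_edge_sets E ?X"
  let ?I = "\<lambda>u. independent_sets E (?X - N u)"
  let ?P = "\<lambda>u. (\<lambda>B. insert v (insert u B)) ` ?I u"
  \<comment> \<open>Among the sets that contain \<open>v\<close>, the part in \<open>N v\<close> tells the families apart.\<close>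
  have trace: "A \<inter> N v = {u}" if "A \<in> ?P u" "u \<in> N v" for A u
    using that not_neighbour_self[of v] by (auto simp: independent_sets_def)
  have "card ?R2 = s ?X"
    by (rule card_image, rule inj_onI) (auto simp: one_edge_sets_def)
  moreover have "card (?P u) = card (?I u)" if "u \<in> N v" for u
  proof (rule card_image, rule inj_onI)
    fix B C assume "B \<in> ?I u" "C \<in> ?I u" and eq: "insert v (insert u B) = insert v (insert u C)"
    then have "B \<inter> {v, u} = {}" "C \<inter> {v, u} = {}"
      using that by (auto simp: independent_sets_def)
    then have "B = insert v (insert u B) - {v, u}" "C = insert v (insert u C) - {v, u}" by blast+
    with eq show "B = C" by simp
  qed
  moreover have "card (\<Union>u\<in>N v \<inter> W. ?P u) = (\<Sum>u\<in>N v \<inter> W. card (?P u))"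
  proof (rule card_UN_disjoint)
    show "\<forall>u\<in>N v \<inter> W. \<forall>w\<in>N v \<inter> W. u \<noteq> w \<longrightarrow> ?P u \<inter> ?P w = {}"
    proof (intro ballI impI equals0I)
      fix u w A assume uw: "u \<in> N v \<inter> W" "w \<in> N v \<inter> W" "u \<noteq> w" and A: "A \<in> ?P u \<inter> ?P w"
      have "{u} = {w}" using trace[of A u] trace[of A w] uw A by simp
      with uw show False by simp
    qed
  qed (use assms(1) in auto)
  moreover have "?R1 \<inter> ?R2 = {}" by (auto simp: one_edge_sets_def)
  moreover have "(?R1 \<union> ?R2) \<inter> (\<Union>u\<in>N v \<inter> W. ?P u) = {}"
  proof -
    have "A \<inter> N v = {}" if "A \<in> ?R2" for A
      using that not_neighbour_self[of v] by (auto simp: one_edge_sets_def)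
    moreover have "v \<notin> A" if "A \<in> ?R1" for A
      using that by (auto simp: one_edge_sets_def)
    ultimately show ?thesis using trace by blast
  qed
  ultimately show ?thesis
    using assms by (simp add: one_edge_sets_split[of v W] card_Un_disjoint)
qed

text \<open>
  Here no edges survive the deletion of \<open>v\<close>, so every count on the right of the recurrences is zero
  or a power of two. The isolated vertices multiply both counts by the same power and cancel.
\<close>

lemma star_ratio:
  assumes "finite W" "v \<in> W" and star: "\<And>e. e \<in> E \<Longrightarrow> e \<subseteq> W \<Longrightarrow> v \<in> e"
  defines "d \<equiv> card (N v \<inter> W)"
  shows "real (s W) / real (i W) = real d / (2 ^ d + 1)"
proof -
  let ?X = "W - insert v (N v)"
  have no: "\<not> e \<subseteq> W - {v}" if "e \<in> E" for e
    using star[OF that] by blast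
  have noX: "\<not> e \<subseteq> ?X" if "e \<in> E" for e
    using no[OF that] by blast
  have leaf: "?X - N u = ?X" if "u \<in> N v \<inter> W" for u
  proof -
    have "w \<notin> ?X" if "w \<in> N u" for w
      using star[of "{u, w}"] that \<open>u \<in> N v \<inter> W\<close> not_neighbour_self[of v] by (auto simp: neighbours_def)
    then show ?thesis by blast
  qed
  have W: "W - {v} = ?X \<union> (N v \<inter> W)" using not_neighbour_self[of v] by blast
  have n: "card (W - {v}) = card ?X + d"
    unfolding W d_def using assms(1) by (intro card_Un_disjoint) auto
  have "i W = 2 ^ (card ?X + d) + 2 ^ card ?X"
    using independent_sets_recurrence[OF assms(1,2)] n
      independent_sets_edgeless[OF no] independent_sets_edgeless[OF noX] assms(1)
    by (simp add: card_Pow)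
  then have "i W = 2 ^ card ?X * (2 ^ d + 1)"
    by (simp add: power_add)
  moreover have "s W = (\<Sum>u\<in>N v \<inter> W. i (?X - N u))"
    using one_edge_sets_recurrence[OF assms(1,2)]
      one_edge_sets_edgeless[OF no] one_edge_sets_edgeless[OF noX] by simp
  then have "s W = d * 2 ^ card ?X"
    using leaf independent_sets_edgeless[OF noX] assms(1) by (simp add: card_Pow d_def)
  ultimately have "real (s W) = 2 ^ card ?X * real d" "real (i W) = 2 ^ card ?X * (2 ^ d + 1)"
    by (simp_all add: algebra_simps)
  then show ?thesis by (simp only: mult_divide_mult_cancel_left) simp
qed

end

section \<open>The bounding function\<close>

definition min_ratio :: "nat \<Rightarrow> real" where
  "min_ratio d = min (1 / 3) (real d / (2 ^ d + 1))"

text \<open>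
  At \<open>d = 1\<close> the value is already the cap \<open>1 / 3\<close>; from \<open>d = 2\<close> on the uncapped ratio decreases.
  The hypothesis \<open>1 \<le> d\<close> excludes the value \<open>0\<close> at \<open>d = 0\<close>.
\<close>

lemma min_ratio_antimono:
  assumes "1 \<le> d" "d \<le> D"
  shows "min_ratio D \<le> min_ratio d"
  using assms(2,1)
proof (induction D rule: dec_induct)
  case (step n)
  have "min_ratio (Suc n) \<le> min_ratio n"
  proof (cases "n = 1")
    case True
    then show ?thesis by (simp add: min_ratio_def)
  next
    case False
    then have n: "2 \<le> real n" using step by linarith
    have "1 + 2 ^ n \<le> (2::real) * 2 ^ n" by simp
    also have "\<dots> \<le> real n * 2 ^ n" using n by (intro mult_right_mono) auto
    finally have "real (Suc n) / (2 ^ Suc n + 1) \<le> real n / (2 ^ n + 1)"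
      by (simp add: divide_simps add_pos_pos algebra_simps)
    then show ?thesis unfolding min_ratio_def by (intro min.mono) simp_all
  qed
  then show ?case using step by simp
qed simp

lemma min_ratio_eq_star_ratio_iff: "min_ratio d = real d / (2 ^ d + 1) \<longleftrightarrow> d \<noteq> 2"
proof (cases "d \<le> 2")
  case True
  then consider "d = 0" | "d = 1" | "d = 2" by force
  then show ?thesis by cases (auto simp: min_ratio_def)
next
  case False
  then have "3 \<le> d" by simp
  then have "3 * d \<le> 2 ^ d + 1"
    by (induction d rule: dec_induct) auto
  then have "real (3 * d) \<le> real (2 ^ d + 1)" by (simp only: of_nat_le_iff)
  then have "real d / (2 ^ d + 1) \<le> 1 / 3"
    by (simp add: divide_simps add_pos_pos)
  then show ?thesis using False by (auto simp: min_ratio_def)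
qed

section \<open>The lower bound\<close>

context edge_set
begin

text \<open>
  Both recurrences are compared term by term. The induction hypothesis covers \<open>W - {v}\<close>, and it
  covers \<open>W - insert v (N v)\<close> unless no edge is left there; in that case the sets whose only edge
  joins \<open>v\<close> to a neighbour are numerous enough, because no neighbour of \<open>v\<close> has larger degree
  than \<open>v\<close>.
\<close>

lemma strict_if_edge_avoids:
  assumes fin: "finite W" and v: "v \<in> W"
    and deg: "\<And>u. u \<in> W \<Longrightarrow> card (N u \<inter> W) \<le> card (N v \<inter> W)"
    and pos: "1 \<le> card (N v \<inter> W)"
    and avoid: "\<exists>e\<in>E. e \<subseteq> W - {v}"
    and IH: "\<And>U. U \<subset> W \<Longrightarrow> \<exists>e\<in>E. e \<subseteq> U \<Longrightarrow> min_ratio (card (N v \<inter> W)) * i U \<le> s U"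
  shows "min_ratio (card (N v \<inter> W)) * i W < s W"
proof -
  define d where "d = card (N v \<inter> W)"
  define T where "T = (\<Sum>u\<in>N v \<inter> W. i (W - insert v (N v) - N u))"
  let ?X = "W - insert v (N v)"
  have "min_ratio d * i (W - {v}) \<le> s (W - {v})"
    unfolding d_def using v avoid by (intro IH) auto
  moreover have "min_ratio d * i ?X < s ?X + T"
  proof (cases "\<exists>e\<in>E. e \<subseteq> ?X")
    case True
    have "0 < T"
      unfolding T_def using fin pos card_independent_sets_pos[OF _ empty_not_edge]
      by (intro sum_pos) (auto simp: card_gt_0_iff)
    moreover have "min_ratio d * i ?X \<le> s ?X"
      unfolding d_def using v True by (intro IH) auto
    ultimately show ?thesis by simp
  next
    case False
    have noX: "\<not> e \<subseteq> ?X" if "e \<in> E" for e using False that by blast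
    have iX: "i ?X = 2 ^ card ?X"
      using independent_sets_edgeless[OF noX] fin by (simp add: card_Pow)
    \<comment> \<open>One of the at most \<open>d\<close> neighbours of \<open>u\<close> is \<open>v\<close>, which lies outside \<open>?X\<close>.\<close>
    have "i ?X \<le> 2 ^ (d - 1) * i (?X - N u)" if u: "u \<in> N v \<inter> W" for u
    proof -
      have "v \<in> N u \<inter> W" using u v neighbours_sym by blast
      then have "card (N u \<inter> W - {v}) \<le> d - 1"
        using deg[of u] u fin by (simp add: d_def)
      moreover have "card (N u \<inter> ?X) \<le> card (N u \<inter> W - {v})"
        using fin by (intro card_mono) auto
      ultimately have le: "card (N u \<inter> ?X) \<le> d - 1" by simp
      have "card ?X = card (N u \<inter> ?X) + card (?X - N u)"
        using card_Int_Diff[of ?X "N u"] fin by (simp add: Int_commute)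
      then have "card ?X \<le> (d - 1) + card (?X - N u)" using le by simp
      then have "(2::nat) ^ card ?X \<le> 2 ^ (d - 1) * 2 ^ card (?X - N u)"
        unfolding power_add[symmetric] by (intro power_increasing) auto
      moreover have "i (?X - N u) = 2 ^ card (?X - N u)"
        using noX fin by (subst independent_sets_edgeless) (blast, simp add: card_Pow)
      ultimately show ?thesis using iX by simp
    qed
    then have "(\<Sum>u\<in>N v \<inter> W. i ?X) \<le> (\<Sum>u\<in>N v \<inter> W. 2 ^ (d - 1) * i (?X - N u))"
      by (rule sum_mono)
    then have "d * i ?X \<le> 2 ^ (d - 1) * T"
      by (simp add: d_def T_def sum_distrib_left)
    \<comment> \<open>A factor \<open>2\<close> can be given away, as \<open>d / (2 ^ d + 1) < d / 2 ^ d\<close> is already strict.\<close>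
    then have "d * i ?X \<le> 2 ^ d * T"
      by (rule order_trans) (intro mult_right_mono power_increasing, auto)
    then have "real d * real (i ?X) \<le> 2 ^ d * real T"
      by (metis of_nat_le_iff of_nat_mult of_nat_numeral of_nat_power)
    then have "real d * real (i ?X) / 2 ^ d \<le> real T"
      by (simp add: divide_simps mult.commute)
    moreover have "min_ratio d * i ?X < real d * real (i ?X) / 2 ^ d"
    proof -
      have "min_ratio d \<le> real d / (2 ^ d + 1)" by (simp add: min_ratio_def)
      also have "\<dots> < real d / 2 ^ d" using pos by (intro divide_strict_left_mono) (auto simp: d_def add_pos_pos)
      finally show ?thesis using iX by (simp add: divide_simps)
    qed
    ultimately show ?thesis by simp
  qed
  moreover have "i W = i (W - {v}) + i ?X"
    by (rule independent_sets_recurrence[OF fin v])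
  moreover have "s W = s (W - {v}) + s ?X + T"
    unfolding T_def by (rule one_edge_sets_recurrence[OF fin v])
  ultimately show ?thesis by (simp add: d_def distrib_left)
qed

text \<open>
  The bound \<open>D\<close> may exceed the maximum degree, so that the claim passes to induced subgraphs.
  Strictness does not pass in this form: for \<open>D = 3\<close> a single edge also attains the
  ratio \<open>1 / 3\<close>.
\<close>

lemma ratio_bound:
  assumes "finite W" "\<exists>e\<in>E. e \<subseteq> W" "\<And>u. u \<in> W \<Longrightarrow> card (N u \<inter> W) \<le> D"
  shows "min_ratio D * i W \<le> s W"
  using assms
proof (induction W arbitrary: D rule: finite_psubset_induct)
  case (psubset W)
  obtain e where e: "e \<in> E" "e \<subseteq> W" using psubset.prems by blast
  obtain x y where xy: "e = {x, y}" using card_edge[OF e(1)] by (auto simp: card_2_iff)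
  then have "x \<in> W" "y \<in> N x \<inter> W" using e by (auto simp: neighbours_def)
  then have x1: "1 \<le> card (N x \<inter> W)"
    using psubset.hyps by (auto simp: Suc_le_eq card_gt_0_iff)
  define d where "d = Max ((\<lambda>u. card (N u \<inter> W)) ` W)"
  have "d \<in> (\<lambda>u. card (N u \<inter> W)) ` W"
    unfolding d_def using psubset.hyps \<open>x \<in> W\<close> by (intro Max_in) auto
  then obtain v where v: "v \<in> W" and dv: "d = card (N v \<inter> W)" by blast
  have deg: "card (N u \<inter> W) \<le> d" if "u \<in> W" for u
    unfolding d_def using psubset.hyps that by (intro Max_ge) auto
  have d1: "1 \<le> d" using deg[OF \<open>x \<in> W\<close>] x1 by simp
  have "min_ratio d * i W \<le> s W"
  proof (cases "\<exists>e\<in>E. e \<subseteq> W - {v}")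
    case True
    have "min_ratio d * i U \<le> s U" if U: "U \<subset> W" "\<exists>e\<in>E. e \<subseteq> U" for U
    proof (rule psubset.IH[OF U])
      fix u assume "u \<in> U"
      have "card (N u \<inter> U) \<le> card (N u \<inter> W)"
        using U psubset.hyps by (intro card_mono) auto
      then show "card (N u \<inter> U) \<le> d" using deg[of u] \<open>u \<in> U\<close> U by auto
    qed
    then show ?thesis
      using strict_if_edge_avoids[OF psubset.hyps v _ _ True] deg d1 dv by fastforce
  next
    case False
    then have "real (s W) / real (i W) = real d / (2 ^ d + 1)"
      unfolding dv using psubset.hyps v by (intro star_ratio) auto
    then have "min_ratio d \<le> real (s W) / real (i W)"
      by (simp add: min_ratio_def)
    then show ?thesis
      using card_independent_sets_pos[OF psubset.hyps empty_not_edge] by (simp add: divide_simps)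
  qed
  moreover have "min_ratio D \<le> min_ratio d"
    using d1 psubset.prems(2)[OF v] dv by (intro min_ratio_antimono) auto
  then have "min_ratio D * i W \<le> min_ratio d * i W"
    by (rule mult_right_mono) simp
  ultimately show ?case by linarith
qed

end

section \<open>Stars with isolated vertices\<close>

lemma finite_edges: "finite_simple_graph G \<Longrightarrow> finite (edges G)"
  unfolding finite_simple_graph_def
  by (metis finite_Pow_iff finite_subset PowI subsetI)

lemma edge_set_edges: "finite_simple_graph G \<Longrightarrow> edge_set (edges G)"
  by unfold_locales (simp add: finite_simple_graph_def)

lemma vertex_degree_eq_card_neighbours:
  assumes "finite_simple_graph G"
  shows "vertex_degree G v = card (neighbours (edges G) v \<inter> verts G)"
proof -
  interpret edge_set "edges G" using assms by (rule edge_set_edges)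
  have "bij_betw (\<lambda>u. {v, u}) (N v \<inter> verts G) {e \<in> edges G. v \<in> e}"
  proof (rule bij_betw_imageI)
    show "inj_on (\<lambda>u. {v, u}) (N v \<inter> verts G)"
      by (rule inj_onI) (auto simp: doubleton_eq_iff)
    show "(\<lambda>u. {v, u}) ` (N v \<inter> verts G) = {e \<in> edges G. v \<in> e}"
    proof (intro equalityI subsetI)
      fix e assume e: "e \<in> {e \<in> edges G. v \<in> e}"
      then have "e \<subseteq> verts G" "e \<subseteq> insert v (verts G)"
        using assms by (auto simp: finite_simple_graph_def)
      moreover obtain x y where "e = {x, y}" using card_edge[of e] e by (auto simp: card_2_iff)
      then obtain w where "e = {v, w}" using e by blast
      ultimately show "e \<in> (\<lambda>u. {v, u}) ` (N v \<inter> verts G)"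
        using e by (auto simp: neighbours_def)
    qed (auto simp: neighbours_def)
  qed
  then show ?thesis
    unfolding vertex_degree_def by (simp add: bij_betw_same_card)
qed

lemma star_graph_ratio:
  assumes G: "finite_simple_graph G" and v: "v \<in> verts G" and star: "\<And>e. e \<in> edges G \<Longrightarrow> v \<in> e"
  shows "real (sigma_graph 1 G) / real (sigma_graph 0 G)
    = real (card (edges G)) / (2 ^ card (edges G) + 1)"
proof -
  interpret edge_set "edges G" using G by (rule edge_set_edges)
  have fin: "finite (verts G)" using G by (simp add: finite_simple_graph_def)
  have "{e \<in> edges G. v \<in> e} = edges G" using star by blast
  then have "card (edges G) = card (N v \<inter> verts G)"
    using vertex_degree_eq_card_neighbours[OF G, of v] by (simp add: vertex_degree_def)
  then show ?thesis
    using star_ratio[OF fin v star] by (simp add: sigma_graph_0[OF fin] sigma_graph_1[unfolded One_nat_def])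
qed

lemma finite_simple_graph_star: "finite_simple_graph (star m)"
  by (auto simp: finite_simple_graph_def star_def)

lemma edges_star: "edges (star (d + 1)) = (\<lambda>k. {0, k}) ` {1..d}"
  by (auto simp: star_def)

lemma card_edges_star: "card (edges (star (d + 1))) = d"
  unfolding edges_star by (subst card_image) (auto simp: inj_on_def doubleton_eq_iff)

lemma sigma_ratio_star:
  "real (sigma_graph 1 (star (d + 1))) / real (sigma_graph 0 (star (d + 1))) = real d / (2 ^ d + 1)"
  using star_graph_ratio[OF finite_simple_graph_star, of 0 "d + 1"]
  by (simp add: card_edges_star[unfolded Suc_eq_plus1[symmetric]]) (auto simp: star_def)

lemma isomorphic_star_edgeless_card_edges:
  assumes G: "finite_simple_graph G"
    and iso: "isomorphic G (disjoint_union (star (d + 1)) (edgeless m))"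
  shows "card (edges G) = d"
proof -
  let ?H = "disjoint_union (star (d + 1)) (edgeless m)"
  obtain f where f: "bij_betw f (verts G) (verts ?H)" "edges ?H = (`) f ` edges G"
    using iso unfolding isomorphic_def by blast
  have "inj_on f (\<Union> (edges G))"
    by (rule inj_on_subset[OF bij_betw_imp_inj_on[OF f(1)]])
      (use G in \<open>auto simp: finite_simple_graph_def\<close>)
  then have "inj_on ((`) f) (edges G)" by (rule inj_on_image)
  then have "card (edges G) = card (edges ?H)"
    unfolding f(2) by (simp add: card_image)
  also have "\<dots> = card (edges (star (d + 1)))"
    by (simp add: disjoint_union_def edgeless_def card_image inj_on_image)
  finally show ?thesis by (simp only: card_edges_star)
qed

text \<open>
  The isomorphism sends the common vertex of all edges to the centre; the leaves and the isolated
  vertices are then matched by arbitrary bijections, which exist because the cardinalities agree.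
\<close>

lemma isomorphic_star_edgeless_iff:
  assumes G: "finite_simple_graph G" and d: "card (edges G) = d"
  shows "isomorphic G (disjoint_union (star (d + 1)) (edgeless (card (verts G) - d - 1)))
    \<longleftrightarrow> (\<exists>v\<in>verts G. \<forall>e\<in>edges G. v \<in> e)"
proof -
  interpret edge_set "edges G" using G by (rule edge_set_edges)
  let ?n = "card (verts G)"
  let ?H = "disjoint_union (star (d + 1)) (edgeless (?n - d - 1))"
  have vH: "verts ?H = {..<d + 1} <+> {..<?n - d - 1}"
    by (simp add: disjoint_union_def star_def edgeless_def)
  have eH: "edges ?H = (\<lambda>k. {Inl 0, Inl k}) ` {1..d}"
    unfolding disjoint_union_def fst_conv snd_conv edges_star
    by (simp add: edgeless_def image_image)
  have fin: "finite (verts G)" using G by (simp add: finite_simple_graph_def)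
  show ?thesis
  proof
    assume "isomorphic G ?H"
    then obtain f where f: "bij_betw f (verts G) (verts ?H)" "edges ?H = (`) f ` edges G"
      unfolding isomorphic_def by blast
    have "Inl 0 \<in> verts ?H" unfolding vH by (intro InlI) simp
    then obtain v where v: "v \<in> verts G" "f v = Inl 0"
      using f(1) by (metis bij_betw_imp_surj_on imageE)
    have "v \<in> e" if e: "e \<in> edges G" for e
    proof -
      have "f ` e \<in> edges ?H" using f(2) e by blast
      then have "Inl 0 \<in> f ` e" unfolding eH by blast
      then obtain w where w: "w \<in> e" "f w = f v" using v by auto
      moreover have "w \<in> verts G" using w e G by (auto simp: finite_simple_graph_def)
      ultimately have "w = v" using f(1) v by (metis bij_betw_imp_inj_on inj_onD)
      then show ?thesis using w by simp
    qed
    then show "\<exists>v\<in>verts G. \<forall>e\<in>edges G. v \<in> e" using v by blast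
  next
    assume "\<exists>v\<in>verts G. \<forall>e\<in>edges G. v \<in> e"
    then obtain v where v: "v \<in> verts G" and star: "\<And>e. e \<in> edges G \<Longrightarrow> v \<in> e" by blast
    define L where "L = N v"
    define R where "R = verts G - insert v L"
    have LV: "L \<subseteq> verts G" and vL: "v \<notin> L"
      using G not_neighbour_self[of v] by (auto simp: L_def neighbours_def finite_simple_graph_def)
    have "{e \<in> edges G. v \<in> e} = edges G" using star by blast
    then have cL: "card L = d"
      using vertex_degree_eq_card_neighbours[OF G, of v] d LV
      by (simp add: vertex_degree_def L_def Int_absorb2)
    have cR: "card R = ?n - d - 1"
      using fin LV vL v cL finite_subset[OF LV fin] unfolding R_def by (subst card_Diff_subset) auto
    have eG: "edges G = (\<lambda>u. {v, u}) ` L"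
    proof (intro equalityI subsetI)
      fix e assume e: "e \<in> edges G"
      obtain x y where "e = {x, y}" using card_edge[OF e] by (auto simp: card_2_iff)
      then obtain w where "e = {v, w}" using star[OF e] by blast
      then show "e \<in> (\<lambda>u. {v, u}) ` L" using e by (auto simp: L_def neighbours_def)
    qed (auto simp: L_def neighbours_def)
    obtain g where g: "bij_betw g L {1..d}"
      using finite_same_card_bij[of L "{1..d}"] finite_subset[OF LV fin] cL by auto
    obtain h where h: "bij_betw h R {..<?n - d - 1}"
      using finite_same_card_bij[of R "{..<?n - d - 1}"] fin cR by (auto simp: R_def)
    define f where "f u = (if u = v then Inl 0 else if u \<in> L then Inl (g u) else Inr (h u))" for u
    have fL: "f u = Inl (g u)" if "u \<in> L" for u using that vL by (auto simp: f_def)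
    have fR: "f u = Inr (h u)" if "u \<in> R" for u using that by (auto simp: f_def R_def)
    have fv: "f v = Inl 0" by (simp add: f_def)
    have gL: "g ` L = {1..d}" and hR: "h ` R = {..<?n - d - 1}"
      using g h by (simp_all add: bij_betw_def)
    have VV: "verts G = insert v (L \<union> R)" using v LV by (auto simp: R_def)
    have "f ` L = Inl ` g ` L" "f ` R = Inr ` h ` R"
      by (simp_all add: image_image fL fR)
    then have "f ` verts G = insert (Inl 0) (Inl ` {1..d}) \<union> Inr ` {..<?n - d - 1}"
      by (simp add: VV image_Un fv gL hR)
    moreover have "{..<d + 1} = insert 0 {1..d}" by auto
    ultimately have im: "f ` verts G = verts ?H"
      unfolding vH Plus_def by simp
    have g0: "g u \<noteq> 0" if "u \<in> L" for u
    proof -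
      have "g u \<in> {1..d}" using that gL by blast
      then show ?thesis by simp
    qed
    have "inj_on f L" "inj_on f R"
      using g h by (simp_all add: bij_betw_def inj_on_def fL fR)
    moreover have "f ` L \<inter> f ` R = {}" by (auto simp: fL fR)
    moreover have "f v \<notin> f ` (L \<union> R)" using g0 by (fastforce simp: fL fR fv)
    ultimately have "inj_on f (verts G)"
      unfolding VV inj_on_insert inj_on_Un by blast
    moreover have "(`) f ` edges G = edges ?H"
      unfolding eG eH gL[symmetric] image_image using fL fv by auto
    ultimately show "isomorphic G ?H"
      unfolding isomorphic_def using im by (auto simp: bij_betw_def)
  qed
qed

section \<open>The inequality and its equality case\<close>

theorem theorem4:
  fixes G :: "'a sgraph" and \<Delta> :: nat
  assumes "finite_simple_graph G"
    and "verts G \<noteq> {}"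
    and "max_degree G = \<Delta>"
  shows "real (sigma_graph 1 G) / real (sigma_graph 0 G)
           \<ge> min (1 / 3) (real (sigma_graph 1 (star (\<Delta> + 1))) / real (sigma_graph 0 (star (\<Delta> + 1)))) \<and>
         (real (sigma_graph 1 G) / real (sigma_graph 0 G)
           = min (1 / 3) (real (sigma_graph 1 (star (\<Delta> + 1))) / real (sigma_graph 0 (star (\<Delta> + 1))))
         \<longleftrightarrow> \<Delta> \<noteq> 2 \<and>
             isomorphic G (disjoint_union (star (\<Delta> + 1)) (edgeless (card (verts G) - \<Delta> - 1))))"
proof -
  note G = assms(1)
  interpret edge_set "edges G" using G by (rule edge_set_edges)
  let ?V = "verts G"
  let ?r = "real (sigma_graph 1 G) / real (sigma_graph 0 G)"
  let ?H = "disjoint_union (star (\<Delta> + 1)) (edgeless (card ?V - \<Delta> - 1))"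
  have fin: "finite ?V" using G by (simp add: finite_simple_graph_def)
  have deg: "vertex_degree G u = card (N u \<inter> ?V)" for u
    by (rule vertex_degree_eq_card_neighbours[OF G])
  have \<Delta>_max: "vertex_degree G u \<le> \<Delta>" if "u \<in> ?V" for u
    using that fin assms(3) unfolding max_degree_def by (metis Max_ge finite_imageI imageI)
  have "\<Delta> \<in> vertex_degree G ` ?V"
    using assms(2) fin unfolding assms(3)[symmetric] max_degree_def by (intro Max_in) auto
  then obtain v where v: "v \<in> ?V" "vertex_degree G v = \<Delta>" by blast
  have i_pos: "0 < i ?V" by (rule card_independent_sets_pos[OF fin empty_not_edge])
  have r: "?r = real (s ?V) / real (i ?V)"
    by (simp only: sigma_graph_0[OF fin] sigma_graph_1)
  have star_ratio_r: "?r = real \<Delta> / (2 ^ \<Delta> + 1)"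
    if "card (edges G) = \<Delta>" "w \<in> ?V" "\<forall>e\<in>edges G. w \<in> e" for w
    using star_graph_ratio[OF G that(2)] that by auto
  note min_eq = min_ratio_eq_star_ratio_iff[of \<Delta>]
  have main: "min_ratio \<Delta> \<le> ?r \<and> (?r = min_ratio \<Delta> \<longleftrightarrow> \<Delta> \<noteq> 2 \<and> isomorphic G ?H)"
  proof (cases "\<forall>e\<in>edges G. v \<in> e")
    case True
    then have "{e \<in> edges G. v \<in> e} = edges G" by blast
    then have c: "card (edges G) = \<Delta>" using v(2) by (simp add: vertex_degree_def)
    have "isomorphic G ?H"
      using isomorphic_star_edgeless_iff[OF G c] True v(1) by blast
    moreover have "?r = real \<Delta> / (2 ^ \<Delta> + 1)" using star_ratio_r[OF c v(1) True] .
    moreover have "min_ratio \<Delta> \<le> real \<Delta> / (2 ^ \<Delta> + 1)" by (simp add: min_ratio_def)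
    ultimately show ?thesis using min_eq by auto
  next
    case False
    then obtain e where e: "e \<in> edges G" "v \<notin> e" by blast
    have eV: "e \<subseteq> ?V" using e G by (auto simp: finite_simple_graph_def)
    obtain x where x: "x \<in> e" using card_edge[OF e(1)] by fastforce
    have "e \<in> {e' \<in> edges G. x \<in> e'}" using e x by blast
    then have "0 < vertex_degree G x"
      unfolding vertex_degree_def using finite_edges[OF G] by (auto simp: card_gt_0_iff)
    then have pos: "1 \<le> \<Delta>" using \<Delta>_max[of x] x eV by fastforce
    have "min_ratio \<Delta> * i ?V < s ?V"
      unfolding v(2)[symmetric] deg
    proof (rule strict_if_edge_avoids[OF fin v(1)])
      show "card (N u \<inter> ?V) \<le> card (N v \<inter> ?V)" if "u \<in> ?V" for u
        using \<Delta>_max[OF that] v(2) deg by simp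
      show "1 \<le> card (N v \<inter> ?V)" using pos v(2) deg by simp
      show "\<exists>e\<in>edges G. e \<subseteq> ?V - {v}" using e eV by blast
      fix U assume U: "U \<subset> ?V" "\<exists>e\<in>edges G. e \<subseteq> U"
      show "min_ratio (card (N v \<inter> ?V)) * i U \<le> s U"
      proof (rule ratio_bound)
        show "finite U" using U fin finite_subset by blast
        fix u assume "u \<in> U"
        have "card (N u \<inter> U) \<le> card (N u \<inter> ?V)" using U fin by (intro card_mono) auto
        also have "\<dots> \<le> card (N v \<inter> ?V)" using \<Delta>_max[of u] U \<open>u \<in> U\<close> v(2) deg by auto
        finally show "card (N u \<inter> U) \<le> card (N v \<inter> ?V)" .
      qed (use U in blast)
    qed
    then have strict: "min_ratio \<Delta> < ?r"
      unfolding r using i_pos by (simp add: divide_simps)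
    moreover have "\<not> (\<Delta> \<noteq> 2 \<and> isomorphic G ?H)"
    proof
      assume iso: "\<Delta> \<noteq> 2 \<and> isomorphic G ?H"
      have "card (edges G) = \<Delta>"
        using iso isomorphic_star_edgeless_card_edges[OF G] by blast
      then obtain w where "w \<in> ?V" "\<forall>e\<in>edges G. w \<in> e"
        using iso isomorphic_star_edgeless_iff[OF G] by blast
      then have "?r = min_ratio \<Delta>"
        using star_ratio_r \<open>card (edges G) = \<Delta>\<close> min_eq iso by simp
      then show False using strict by simp
    qed
    ultimately show ?thesis by linarith
  qed
  then show ?thesis
    unfolding sigma_ratio_star min_ratio_def .
qed

end
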